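(* Let $V$ and $S$ be finite non-empty sets, let $\mathcal{M}$ be the real linear space of Hermitian operators on $L^2_{\mathbb{C}}(V\times S)$, and let $\mathcal{T}:\mathcal{M}\to\mathcal{M}$ be a strongly positive superoperator. Then: (i) $1$ is a simple eigenvalue of $\mathcal{T}$. (ii) The corresponding eigenvector $\rho_{st}$ (normalized to have trace $1$) is a strictly positive density matrix. (iii) For every initial density matrix $\rho_0$, $\mathcal{T}^n\rho_0\to\rho_{st}$ as $n\to\infty$.
   Context: A density matrix is a positive (semidefinite) operator on $L^2_{\mathbb{C}}(V\times S)$ (i.e. $\mathbb{C}^{V\times S}$ with the standard inner product) with trace $1$. A superoperator is a completely positive, trace-preserving linear map on operators on $L^2_{\mathbb{C}}(V\times S)$; it maps density matrices to density matrices and is regarded as a linear operator on $\mathcal{M}$. A density matrix $\rho$ is strictly positive, written $\rho>0$, if $\langle x,\rho x\rangle=0$ implies $x=0$. A linear operator $\mathcal{T}$ on $\mathcal{M}$ is strongly positive if for every density matrix $\rho$ there exists an integer $n>0$ such that $\mathcal{T}^n\rho>0$. The rank of an eigenvalue $\lambda$ of $\mathcal{T}$ is $\sup_{p>0}\dim\ker(\lambda I-\mathcal{T})^p$; the eigenvalue is simple if its rank equals $1$. *)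

theory Defs
  imports "HOL-Analysis.Analysis"
begin

text \<open>
  Operators on the finite-dimensional space of complex functions on a finite non-empty set are
  represented by their matrices with respect to the standard basis, the set being the index type.
\<close>

type_synonym 'n operator = "complex ^ 'n ^ 'n"

definition cscale :: "complex \<Rightarrow> 'n::finite operator \<Rightarrow> 'n operator"
  where "cscale c A = map_matrix (\<lambda>z. c * z) A"

lemma vector_space_cscale: "vector_space (cscale :: complex \<Rightarrow> 'n::finite operator \<Rightarrow> _)"
  by unfold_locales (simp_all add: cscale_def map_matrix_def vec_eq_iff algebra_simps)

definition cinner :: "complex ^ 'n::finite \<Rightarrow> complex ^ 'n \<Rightarrow> complex"
  where "cinner x y = (\<Sum>i\<in>UNIV. cnj (x $ i) * y $ i)"

text \<open>Real subspace of the space of operators, so \<open>dim\<close> below is the real dimension.\<close>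

definition hermitian_operators :: "'n::finite operator set"
  where "hermitian_operators = {A. map_matrix cnj (transpose A) = A}"

lemma subspace_hermitian_operators:
  "subspace (hermitian_operators :: 'n::finite operator set)"
  by (auto simp: subspace_def hermitian_operators_def map_matrix_def transpose_def vec_eq_iff)

definition positive_operator :: "'n::finite operator \<Rightarrow> bool"
  where "positive_operator A \<longleftrightarrow> (\<forall>x. cinner x (A *v x) \<in> \<real>\<^sub>\<ge>\<^sub>0)"

definition density_matrix :: "'n::finite operator \<Rightarrow> bool"
  where "density_matrix \<rho> \<longleftrightarrow> positive_operator \<rho> \<and> trace \<rho> = 1"

definition strictly_positive :: "'n::finite operator \<Rightarrow> bool"
  where "strictly_positive \<rho> \<longleftrightarrow> (\<forall>x. cinner x (\<rho> *v x) = 0 \<longrightarrow> x = 0)"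

text \<open>
  The family \<open>A i j\<close> with \<open>i, j < k\<close> stands for the block operator on the \<open>k\<close>-fold direct sum,
  i.e. for the element \<open>\<Sum>i j. E i j \<otimes> A i j\<close> of the \<open>k \<times> k\<close> matrices with operator entries; the
  components of a vector of the direct sum are \<open>x i\<close> with \<open>i < k\<close>.  Applying a map to every block
  is its tensor product with the identity on \<open>k \<times> k\<close> matrices.
\<close>

definition positive_block_operator :: "nat \<Rightarrow> (nat \<Rightarrow> nat \<Rightarrow> 'n::finite operator) \<Rightarrow> bool"
  where "positive_block_operator k A \<longleftrightarrow>
    (\<forall>x :: nat \<Rightarrow> complex ^ 'n. (\<Sum>i<k. \<Sum>j<k. cinner (x i) (A i j *v x j)) \<in> \<real>\<^sub>\<ge>\<^sub>0)"

definition completely_positive :: "('n::finite operator \<Rightarrow> 'n operator) \<Rightarrow> bool"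
  where "completely_positive T \<longleftrightarrow>
    (\<forall>k A. positive_block_operator k A \<longrightarrow> positive_block_operator k (\<lambda>i j. T (A i j)))"

text \<open>
  A superoperator is a complex-linear map on all operators.  As an operator on the real space
  of Hermitian operators it is the restriction of this map; the notions concerning
  eigenvalues below refer to this restriction.
\<close>

definition superoperator :: "('n::finite operator \<Rightarrow> 'n operator) \<Rightarrow> bool"
  where "superoperator T \<longleftrightarrow>
    Vector_Spaces.linear cscale cscale T \<and> completely_positive T \<and> (\<forall>A. trace (T A) = trace A)"

definition strongly_positive :: "('n::finite operator \<Rightarrow> 'n operator) \<Rightarrow> bool"
  where "strongly_positive T \<longleftrightarrow>
    (\<forall>\<rho>. density_matrix \<rho> \<longrightarrow> (\<exists>n>0. strictly_positive ((T ^^ n) \<rho>)))"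

definition eigenvector_on_hermitian ::
    "('n::finite operator \<Rightarrow> 'n operator) \<Rightarrow> real \<Rightarrow> 'n operator \<Rightarrow> bool"
  where "eigenvector_on_hermitian T l X \<longleftrightarrow>
    X \<in> hermitian_operators \<and> X \<noteq> 0 \<and> T X = l *\<^sub>R X"

text \<open>The supremum is over a set of natural numbers bounded by the dimension of the whole space.\<close>

definition eigenvalue_rank :: "('n::finite operator \<Rightarrow> 'n operator) \<Rightarrow> real \<Rightarrow> nat"
  where "eigenvalue_rank T l =
    (SUP p\<in>{p::nat. p > 0}. dim {X \<in> hermitian_operators. ((\<lambda>Y. l *\<^sub>R Y - T Y) ^^ p) X = 0})"

definition simple_eigenvalue :: "('n::finite operator \<Rightarrow> 'n operator) \<Rightarrow> real \<Rightarrow> bool"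
  where "simple_eigenvalue T l \<longleftrightarrow>
    (\<exists>X. eigenvector_on_hermitian T l X) \<and> eigenvalue_rank T l = 1"

end

theory Submission
  imports Defs
begin

text \<open>
  Doeblin's argument.  By compactness some power \<open>T ^^ N\<close> maps all density matrices above
  \<open>\<epsilon> I\<close> for one \<open>\<epsilon> > 0\<close>.  Subtracting the common part \<open>\<epsilon> I\<close>, the difference of the images of two
  density matrices is \<open>1 - \<epsilon> d\<close> (\<open>d\<close> the dimension) times a difference of density matrices, so that differences decay
  geometrically and every orbit of density matrices converges to one common fixed point \<open>\<rho>st\<close>.
  Every Hermitian operator \<open>X\<close> is a real combination of two density matrices, hence its iterates
  under \<open>T\<close> converge to \<open>(trace X) \<rho>st\<close>; this gives uniqueness of the fixed point, and the
  absence of generalized eigenvectors because \<open>X - T X\<close> has trace zero.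
\<close>

subsection \<open>Quadratic forms of operators\<close>

abbreviation quadform :: "'n::finite operator \<Rightarrow> complex ^ 'n \<Rightarrow> complex"
  where "quadform A x \<equiv> cinner x (A *v x)"

lemma quadform_expand: "quadform A x = (\<Sum>i\<in>UNIV. \<Sum>j\<in>UNIV. cnj (x $ i) * A $ i $ j * x $ j)"
  by (simp add: cinner_def matrix_vector_mult_def sum_distrib_left mult.assoc)

lemma quadform_diff: "quadform (A - B) x = quadform A x - quadform B x"
  unfolding quadform_expand by (simp add: algebra_simps sum_subtractf)

lemma quadform_scaleR: "quadform (r *\<^sub>R A) x = r *\<^sub>R quadform A x"
  by (simp add: quadform_expand scaleR_sum_right)

lemma quadform_scaleR_vec: "quadform A (r *\<^sub>R x) = r\<^sup>2 *\<^sub>R quadform A x"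
  by (simp add: quadform_expand scaleR_sum_right power2_eq_square mult.assoc)

lemma quadform_mat_1: "quadform (mat 1) x = of_real ((norm x)\<^sup>2)"
proof -
  have "quadform (mat 1) x = (\<Sum>i\<in>UNIV. of_real ((norm (x $ i))\<^sup>2))"
    by (simp add: cinner_def complex_norm_square mult.commute del: of_real_power)
  also have "\<dots> = of_real ((norm x)\<^sup>2)"
    by (simp add: norm_vec_def L2_set_def sum_nonneg)
  finally show ?thesis .
qed

text \<open>Vectors supported on at most two coordinates are the test vectors from which single
  entries are recovered; \<open>i = j\<close> is allowed, and \<open>b = 0\<close> isolates a
  diagonal entry.\<close>

lemma quadform_axis_add_axis:
  "quadform A (axis i a + axis j b) =
    cnj a * A $ i $ i * a + cnj a * A $ i $ j * b + cnj b * A $ j $ i * a + cnj b * A $ j $ j * b"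
proof -
  have ax: "cinner (axis k c) y = cnj c * y $ k" for k c and y :: "complex ^ 'n"
    by (simp add: cinner_def axis_def if_distrib[of cnj] if_distrib[of "\<lambda>z. z * _"]
        sum.delta cong: if_cong)
  have mv: "(A *v axis k c) $ l = A $ l $ k * c" for k l c
    by (simp add: matrix_vector_mult_def axis_def if_distrib[of "\<lambda>z. _ * z"] sum.delta
        cong: if_cong)
  have add: "cinner (x + y) z = cinner x z + cinner y z" for x y z :: "complex ^ 'n"
    by (simp add: cinner_def algebra_simps sum.distrib)
  show ?thesis
    by (simp add: add ax mv matrix_vector_right_distrib algebra_simps)
qed

text \<open>The converse is polarization: the test vectors \<open>axis i 1 + axis j 1\<close> and
  \<open>axis i 1 + axis j \<i>\<close> compare the imaginary and the real parts of
  \<open>A $ i $ j\<close> and \<open>A $ j $ i\<close>.\<close>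

lemma hermitian_iff_quadform:
  "A \<in> hermitian_operators \<longleftrightarrow> (\<forall>x. Im (quadform A x) = 0)"
proof
  assume "A \<in> hermitian_operators"
  then have h: "cnj (A $ j $ i) = A $ i $ j" for i j
    by (simp add: hermitian_operators_def map_matrix_def transpose_def vec_eq_iff)
  show "\<forall>x. Im (quadform A x) = 0"
  proof
    fix x
    have "cnj (quadform A x) = (\<Sum>i\<in>UNIV. \<Sum>j\<in>UNIV. cnj (x $ j) * A $ j $ i * x $ i)"
      by (simp add: quadform_expand h algebra_simps)
    also have "\<dots> = quadform A x"
      unfolding quadform_expand by (rule sum.swap)
    finally show "Im (quadform A x) = 0"
      by (simp add: complex_eq_iff)
  qed
next
  assume q: "\<forall>x. Im (quadform A x) = 0"
  have diag: "Im (A $ i $ i) = 0" for i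
    using q[rule_format, of "axis i 1 + axis i 0"] by (simp add: quadform_axis_add_axis)
  have "Im (A $ i $ j) + Im (A $ j $ i) = 0" for i j
    using q[rule_format, of "axis i 1 + axis j 1"] diag[of i] diag[of j]
    by (simp add: quadform_axis_add_axis)
  moreover have "Re (A $ i $ j) = Re (A $ j $ i)" for i j
    using q[rule_format, of "axis i 1 + axis j \<i>"] diag[of i] diag[of j]
    by (simp add: quadform_axis_add_axis)
  ultimately show "A \<in> hermitian_operators"
    unfolding hermitian_operators_def map_matrix_def transpose_def
    by (simp add: vec_eq_iff complex_eq_iff) (metis add.commute add_eq_0_iff)
qed

subsection \<open>Positive operators and density matrices\<close>

lemma hermitian_diff:
  "A \<in> hermitian_operators \<Longrightarrow> B \<in> hermitian_operators \<Longrightarrow> A - B \<in> hermitian_operators"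
  by (rule subspace_diff[OF subspace_hermitian_operators])

lemma hermitian_scaleR: "A \<in> hermitian_operators \<Longrightarrow> r *\<^sub>R A \<in> hermitian_operators"
  by (rule subspace_scale[OF subspace_hermitian_operators])

lemma positive_operator_iff:
  "positive_operator A \<longleftrightarrow> A \<in> hermitian_operators \<and> (\<forall>x. 0 \<le> Re (quadform A x))"
  by (auto simp: positive_operator_def hermitian_iff_quadform complex_nonneg_Reals_iff)

lemma positive_operator_hermitian: "positive_operator A \<Longrightarrow> A \<in> hermitian_operators"
  by (simp add: positive_operator_iff)

lemma positive_operator_scaleR:
  "positive_operator A \<Longrightarrow> 0 \<le> r \<Longrightarrow> positive_operator (r *\<^sub>R A)"
  by (simp add: positive_operator_iff quadform_scaleR hermitian_scaleR)

lemma positive_operator_mat_1: "positive_operator (mat 1)"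
  unfolding positive_operator_iff hermitian_iff_quadform quadform_mat_1 by simp

lemma strictly_positive_mat_1: "strictly_positive (mat 1)"
  unfolding strictly_positive_def quadform_mat_1 by simp

text \<open>The form of a positive operator is real and nonnegative, so nonvanishing means
  positivity, and homogeneity reduces to unit vectors. The compact sphere is what later makes strict
  positivity an open condition with attained minima.\<close>

lemma strictly_positive_iff_Re:
  assumes "positive_operator A"
  shows "strictly_positive A \<longleftrightarrow> (\<forall>x\<in>sphere 0 1. 0 < Re (quadform A x))"
proof
  assume s: "strictly_positive A"
  show "\<forall>x\<in>sphere 0 1. 0 < Re (quadform A x)"
  proof
    fix x :: "complex ^ 'a" assume "x \<in> sphere 0 1"
    then have "quadform A x \<noteq> 0"
      using s by (auto simp: strictly_positive_def)
    then show "0 < Re (quadform A x)"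
      using assms by (auto simp: positive_operator_iff hermitian_iff_quadform complex_eq_iff
          order.strict_iff_order)
  qed
next
  assume s: "\<forall>x\<in>sphere 0 1. 0 < Re (quadform A x)"
  have "quadform A x \<noteq> 0" if "x \<noteq> 0" for x
  proof -
    have "0 < Re (quadform A ((1 / norm x) *\<^sub>R x))"
      using s that by simp
    then show ?thesis
      unfolding quadform_scaleR_vec by auto
  qed
  then show "strictly_positive A"
    by (auto simp: strictly_positive_def)
qed

lemma quadform_nonneg_if_sphere:
  assumes "\<And>x. x \<in> sphere 0 1 \<Longrightarrow> 0 \<le> Re (quadform A x)"
  shows "0 \<le> Re (quadform A x)"
proof (cases "x = 0")
  case False
  have "x = norm x *\<^sub>R ((1 / norm x) *\<^sub>R x)"
    using False by simp
  then have "quadform A x = (norm x)\<^sup>2 *\<^sub>R quadform A ((1 / norm x) *\<^sub>R x)"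
    by (metis quadform_scaleR_vec)
  then show ?thesis
    using assms[of "(1 / norm x) *\<^sub>R x"] False by simp
qed (simp add: cinner_def)

lemma sphere_vec_nonempty: "sphere (0 :: complex ^ 'n::finite) 1 \<noteq> {}"
  by (simp add: sphere_eq_empty)

text \<open>On the compact unit sphere the form of \<open>A\<close> has a positive minimum and the
  form of \<open>B\<close> a finite maximum; \<open>c\<close> is essentially the ratio of the
  two.\<close>

lemma strictly_positive_dominates:
  fixes A B :: "'n::finite operator"
  assumes A: "positive_operator A" "strictly_positive A" and B: "B \<in> hermitian_operators"
  obtains c where "c > 0" "positive_operator (c *\<^sub>R A - B)"
proof -
  let ?S = "sphere (0 :: complex ^ 'n) 1"
  have cont: "continuous_on ?S (\<lambda>x. Re (quadform C x))" for C :: "'n operator"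
    unfolding quadform_expand by (intro continuous_intros)
  obtain a where a: "a \<in> ?S" "\<And>x. x \<in> ?S \<Longrightarrow> Re (quadform A a) \<le> Re (quadform A x)"
    using continuous_attains_inf[OF compact_sphere sphere_vec_nonempty cont] by metis
  obtain b where b: "\<And>x. x \<in> ?S \<Longrightarrow> Re (quadform B x) \<le> Re (quadform B b)"
    using continuous_attains_sup[OF compact_sphere sphere_vec_nonempty cont] by metis
  define e where "e = Re (quadform A a)"
  \<comment> \<open>The \<open>max 1\<close> makes \<open>M\<close> positive even when the form of
    \<open>B\<close> is not, so that \<open>M / e\<close> is a positive factor.\<close>
  define M where "M = max 1 (Re (quadform B b))"
  have e: "e > 0"
    using A(2) a(1) strictly_positive_iff_Re[OF A(1)] unfolding e_def by blast
  have "M \<le> M / e * Re (quadform A x)" if "x \<in> ?S" for x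
  proof -
    have "M / e * e \<le> M / e * Re (quadform A x)"
      using a(2)[OF that] e by (intro mult_left_mono) (auto simp: e_def M_def)
    then show ?thesis
      using e by simp
  qed
  then have "0 \<le> Re (quadform ((M / e) *\<^sub>R A - B) x)" if "x \<in> ?S" for x
    using b[OF that] that by (fastforce simp: quadform_diff quadform_scaleR M_def)
  then have "positive_operator ((M / e) *\<^sub>R A - B)"
    using A(1) B unfolding positive_operator_iff
    by (metis quadform_nonneg_if_sphere hermitian_diff hermitian_scaleR)
  moreover have "M / e > 0"
    using e by (simp add: M_def)
  ultimately show ?thesis
    using that by blast
qed

lemma trace_scaleR: "trace (r *\<^sub>R A) = r *\<^sub>R trace (A :: 'n::finite operator)"
  by (simp add: trace_def scaleR_sum_right)

lemma hermitian_trace_real: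
  assumes "A \<in> hermitian_operators" shows "trace A = of_real (Re (trace A))"
proof -
  have "cnj (A $ i $ i) = A $ i $ i" for i
    using assms by (simp add: hermitian_operators_def map_matrix_def transpose_def vec_eq_iff)
  then have "cnj (trace A) = trace A"
    by (simp add: trace_def)
  then show ?thesis
    by (simp add: complex_eq_iff)
qed

text \<open>Nonnegativity on \<open>axis i 1 + axis j b\<close> for \<open>b\<close> in 1, -1,
  \<open>\<i>\<close>, \<open>-\<i>\<close> bounds the real and imaginary parts of an entry by
  diagonal entries, hence by the trace. This makes density matrices bounded and a positive operator
  of trace zero vanish.\<close>

lemma positive_operator_entries:
  assumes "positive_operator A"
  shows "0 \<le> Re (A $ i $ i)"
    and "norm (A $ i $ j) \<le> 2 * Re (trace A)"
proof -
  have q: "0 \<le> Re (quadform A x)" for x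
    using assms by (simp add: positive_operator_iff)
  have h: "A $ j $ i = cnj (A $ i $ j)" for i j
    using positive_operator_hermitian[OF assms]
    by (simp add: hermitian_operators_def map_matrix_def transpose_def vec_eq_iff)
  show diag: "0 \<le> Re (A $ i $ i)" for i
    using q[of "axis i 1 + axis i 0"] by (simp add: quadform_axis_add_axis)
  have tr: "Re (A $ i $ i) \<le> Re (trace A)" for i
    unfolding trace_def Re_sum by (rule member_le_sum) (use diag in auto)
  have "\<bar>Re (A $ i $ j)\<bar> \<le> Re (trace A)"
    using q[of "axis i 1 + axis j 1"] q[of "axis i 1 + axis j (-1)"] tr[of i] tr[of j] h[of j i]
    by (simp add: quadform_axis_add_axis)
  moreover have "\<bar>Im (A $ i $ j)\<bar> \<le> Re (trace A)"
    using q[of "axis i 1 + axis j \<i>"] q[of "axis i 1 + axis j (-\<i>)"] tr[of i] tr[of j] h[of j i]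
    by (simp add: quadform_axis_add_axis)
  ultimately show "norm (A $ i $ j) \<le> 2 * Re (trace A)"
    using cmod_le[of "A $ i $ j"] by linarith
qed

lemma closed_positive_operators: "closed {A :: 'n::finite operator. positive_operator A}"
proof -
  have "closed {A :: 'n operator. \<forall>x. Im (quadform A x) = 0 \<and> 0 \<le> Re (quadform A x)}"
    unfolding quadform_expand
    by (intro closed_Collect_all closed_Collect_conj closed_Collect_eq closed_Collect_le
        continuous_intros)
  then show ?thesis
    by (simp add: positive_operator_iff hermitian_iff_quadform all_conj_distrib)
qed

lemma bounded_density_matrices: "bounded {A :: 'n::finite operator. density_matrix A}"
proof -
  have "norm A \<le> (\<Sum>i\<in>(UNIV :: 'n set). \<Sum>j\<in>(UNIV :: 'n set). 2)"
    if "density_matrix A" for A :: "'n operator"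
  proof -
    have "norm A \<le> (\<Sum>i\<in>UNIV. norm (A $ i))"
      by (simp add: norm_vec_def L2_set_le_sum)
    also have "\<dots> \<le> (\<Sum>i\<in>UNIV. \<Sum>j\<in>UNIV. norm (A $ i $ j))"
      by (intro sum_mono) (simp add: norm_vec_def L2_set_le_sum)
    also have "\<dots> \<le> (\<Sum>i\<in>(UNIV :: 'n set). \<Sum>j\<in>(UNIV :: 'n set). 2)"
      using positive_operator_entries(2)[of A] that
      by (intro sum_mono) (simp add: density_matrix_def)
    finally show ?thesis .
  qed
  then show ?thesis
    unfolding bounded_iff by blast
qed

lemma compact_density_matrices: "compact {A :: 'n::finite operator. density_matrix A}"
proof -
  have "closed {A :: 'n operator. trace A = 1}"
    unfolding trace_def by (intro closed_Collect_eq continuous_intros)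
  then have "closed {A :: 'n operator. density_matrix A}"
    unfolding density_matrix_def Collect_conj_eq
    using closed_positive_operators by (rule closed_Int[rotated])
  then show ?thesis
    using bounded_density_matrices compact_eq_bounded_closed by blast
qed

lemma positive_operator_eq_scaleR_density_matrix:
  fixes A :: "'n::finite operator"
  assumes "positive_operator A" "0 < Re (trace A)"
  obtains \<rho> where "density_matrix \<rho>" "A = Re (trace A) *\<^sub>R \<rho>"
proof
  let ?r = "Re (trace A)"
  show "density_matrix ((1 / ?r) *\<^sub>R A)"
    using assms hermitian_trace_real[OF positive_operator_hermitian[OF assms(1)]]
      positive_operator_scaleR[OF assms(1), of "1 / ?r"]
    unfolding density_matrix_def trace_scaleR
    by (metis divide_nonneg_pos less_irrefl nonzero_eq_divide_eq of_real_1 of_real_mult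
        scaleR_conv_of_real zero_le_one)
  show "A = ?r *\<^sub>R ((1 / ?r) *\<^sub>R A)"
    using assms(2) by simp
qed

lemma trace_mat_1: "trace (mat 1 :: 'n::finite operator) = of_nat CARD('n)"
  by (simp add: trace_def mat_def)

lemma density_matrix_exists:
  obtains \<rho> :: "'n::finite operator" where "density_matrix \<rho>"
proof -
  have "0 < Re (trace (mat 1 :: 'n operator))"
    by (simp add: trace_mat_1)
  then show ?thesis
    using positive_operator_eq_scaleR_density_matrix[OF positive_operator_mat_1] that by blast
qed

text \<open>For large \<open>c\<close> both terms of \<open>X = c I - (c I - X)\<close> are
  positive, and each is normalized by its trace.\<close>

lemma hermitian_eq_diff_density_matrices:
  fixes X :: "'n::finite operator"
  assumes "X \<in> hermitian_operators"
  obtains a b \<rho> \<sigma> where "density_matrix \<rho>" "density_matrix \<sigma>" "X = a *\<^sub>R \<rho> - b *\<^sub>R \<sigma>"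
proof -
  obtain c where c: "c > 0" "positive_operator (c *\<^sub>R mat 1 - X)"
    using strictly_positive_dominates[OF positive_operator_mat_1 strictly_positive_mat_1 assms] .
  let ?I = "mat 1 :: 'n operator"
  have I: "0 < Re (trace ?I)"
    by (simp add: trace_mat_1)
  then obtain \<rho> where \<rho>: "density_matrix \<rho>" "?I = Re (trace ?I) *\<^sub>R \<rho>"
    using positive_operator_eq_scaleR_density_matrix[OF positive_operator_mat_1] by metis
  let ?P = "c *\<^sub>R ?I - X"
  show ?thesis
  proof (cases "0 < Re (trace ?P)")
    case True
    then obtain \<sigma> where \<sigma>: "density_matrix \<sigma>" "?P = Re (trace ?P) *\<^sub>R \<sigma>"
      using positive_operator_eq_scaleR_density_matrix[OF c(2)] by metis
    have "X = c *\<^sub>R (Re (trace ?I) *\<^sub>R \<rho>) - Re (trace ?P) *\<^sub>R \<sigma>"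
      by (simp flip: \<rho>(2) \<sigma>(2))
    then show ?thesis
      using \<rho>(1) \<sigma>(1) that[of \<rho> \<sigma> "c * Re (trace ?I)" "Re (trace ?P)"] by simp
  next
    case False
    \<comment> \<open>Here \<open>?P\<close> has trace zero and cannot be normalized; but then it
      vanishes, and coefficient 0 with any density matrix serves as the second term.\<close>
    have "0 \<le> Re (trace ?P)"
      using positive_operator_entries(1)[OF c(2)] by (auto simp: trace_def sum_nonneg)
    with False have "Re (trace ?P) = 0"
      by linarith
    then have "?P $ i $ j = 0" for i j
      using positive_operator_entries(2)[OF c(2), of i j] by simp
    then have "X = c *\<^sub>R ?I"
      by (simp add: vec_eq_iff)
    also have "\<dots> = c *\<^sub>R (Re (trace ?I) *\<^sub>R \<rho>)"
      by (simp flip: \<rho>(2))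
    finally have "X = (c * Re (trace ?I)) *\<^sub>R \<rho> - 0 *\<^sub>R \<rho>"
      by simp
    then show ?thesis
      using \<rho>(1) that by blast
  qed
qed

subsection \<open>Iterates of a strongly positive superoperator\<close>

text \<open>Restriction of scalars: for a real factor \<open>cscale\<close> agrees with
  \<open>scaleR\<close>.\<close>

lemma superoperator_linear:
  fixes T :: "'n::finite operator \<Rightarrow> 'n operator"
  assumes "superoperator T"
  shows "linear T"
proof -
  interpret T: Vector_Spaces.linear cscale cscale T
    using assms by (simp add: superoperator_def)
  have "cscale (of_real r) A = r *\<^sub>R A" for r and A :: "'n operator"
    by (simp add: cscale_def map_matrix_def vec_eq_iff scaleR_conv_of_real[where 'a = complex])
  then show ?thesis
    by (intro linearI) (metis T.add, metis T.scale)
qed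

text \<open>This is complete positivity for a single block, \<open>k = 1\<close>.\<close>

lemma superoperator_positive:
  assumes "superoperator T" "positive_operator A"
  shows "positive_operator (T A)"
proof -
  have "positive_block_operator 1 (\<lambda>i j. A)"
    using assms(2) by (simp add: positive_block_operator_def positive_operator_def)
  then have "positive_block_operator 1 (\<lambda>i j. T A)"
    using assms(1) unfolding superoperator_def completely_positive_def by blast
  then have "quadform (T A) (x 0) \<in> \<real>\<^sub>\<ge>\<^sub>0" for x :: "nat \<Rightarrow> _"
    by (simp add: positive_block_operator_def)
  from this[of "\<lambda>_. x" for x] show ?thesis
    by (simp add: positive_operator_def)
qed

lemma superoperator_funpow:
  assumes "superoperator T"
  shows "linear (T ^^ n)"
    and "positive_operator A \<Longrightarrow> positive_operator ((T ^^ n) A)"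
    and "trace ((T ^^ n) A) = trace A"
    and "density_matrix A \<Longrightarrow> density_matrix ((T ^^ n) A)"
proof -
  show "linear (T ^^ n)"
  proof (induction n)
    case (Suc n)
    then show ?case
      using linear_compose[OF Suc superoperator_linear[OF assms]] by (simp add: o_def)
  qed (simp add: linear_iff)
  show p: "positive_operator ((T ^^ n) A)" if "positive_operator A"
    using that by (induction n) (auto intro: superoperator_positive[OF assms])
  show t: "trace ((T ^^ n) A) = trace A"
    using assms by (induction n) (auto simp: superoperator_def)
  show "density_matrix ((T ^^ n) A)" if "density_matrix A"
    using that p t by (simp add: density_matrix_def)
qed

text \<open>A null vector of \<open>T A\<close> would be a null vector of every
  \<open>(T ^^ n) \<rho>\<close> with \<open>n > 0\<close>, which strong positivity
  excludes.\<close>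

lemma strictly_positive_image:
  assumes T: "superoperator T" "strongly_positive T"
    and A: "positive_operator A" "strictly_positive A"
  shows "strictly_positive (T A)"
  unfolding strictly_positive_def
proof (intro allI impI)
  fix x assume x: "quadform (T A) x = 0"
  interpret linear T
    using T(1) by (rule superoperator_linear)
  \<comment> \<open>As \<open>A\<close> dominates every positive operator, \<open>x\<close> is a null vector of the whole image of \<open>T\<close>.\<close>
  have null: "quadform (T B) x = 0" if B: "positive_operator B" for B
  proof -
    obtain c where "positive_operator (c *\<^sub>R A - B)"
      using strictly_positive_dominates[OF A positive_operator_hermitian[OF B]] .
    then have "positive_operator (c *\<^sub>R T A - T B)"
      using superoperator_positive[OF T(1)] by (fastforce simp: diff scale)
    then have "0 \<le> Re (quadform (c *\<^sub>R T A - T B) x)"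
      by (simp add: positive_operator_iff)
    moreover have "positive_operator (T B)"
      using T(1) B by (rule superoperator_positive)
    ultimately show ?thesis
      using x
      by (auto simp: quadform_diff quadform_scaleR positive_operator_iff hermitian_iff_quadform
          complex_eq_iff intro: antisym)
  qed
  obtain \<rho> :: "'a operator" where \<rho>: "density_matrix \<rho>"
    by (rule density_matrix_exists)
  obtain n where "n > 0" and n: "strictly_positive ((T ^^ n) \<rho>)"
    using T(2) \<rho> by (auto simp: strongly_positive_def)
  \<comment> \<open>Since \<open>n > 0\<close>, the iterate lies in the image of \<open>T\<close> on
    positive operators, where \<open>null\<close> applies.\<close>
  then obtain m where "n = Suc m"
    using gr0_conv_Suc by blast
  then have "quadform ((T ^^ n) \<rho>) x = 0"
    using null superoperator_funpow(2)[OF T(1)] \<rho> by (simp add: density_matrix_def)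
  then show "x = 0"
    using n by (simp add: strictly_positive_def)
qed

text \<open>Exponents that depend on the state can thus be replaced by a common larger one.\<close>

lemma strictly_positive_funpow_mono:
  assumes T: "superoperator T" "strongly_positive T"
    and A: "positive_operator A" "strictly_positive ((T ^^ n) A)" and "n \<le> m"
  shows "strictly_positive ((T ^^ m) A)"
  using \<open>n \<le> m\<close>
proof (induction m rule: dec_induct)
  case (step m)
  then show ?case
    using strictly_positive_image[OF T superoperator_funpow(2)[OF T(1) A(1)]] by simp
qed (rule A(2))

section \<open>Uniform strict positivity of a power\<close>

text \<open>The complement is the projection of a closed set along the compact sphere, hence
  closed.\<close>

lemma open_quadform_pos_on_sphere:
  "open {A :: 'n::finite operator. \<forall>x\<in>sphere 0 1. 0 < Re (quadform A x)}"
proof -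
  let ?C = "{p :: (complex ^ 'n) \<times> 'n operator. Re (quadform (snd p) (fst p)) \<le> 0}"
  have "closed ?C"
    unfolding quadform_expand by (intro closed_Collect_le continuous_intros)
  then have "closed {A. \<exists>x. x \<in> sphere 0 1 \<and> (x, A) \<in> ?C}"
    by (intro closed_compact_projection compact_sphere)
  then have "open (- {A. \<exists>x. x \<in> sphere 0 1 \<and> (x, A) \<in> ?C})"
    by (rule open_Compl)
  moreover have "- {A. \<exists>x. x \<in> sphere 0 1 \<and> (x, A) \<in> ?C}
      = {A :: 'n operator. \<forall>x\<in>sphere 0 1. 0 < Re (quadform A x)}"
    by (auto simp: not_le Ball_def)
  ultimately show ?thesis
    by simp
qed

text \<open>The open sets of operators made strictly positive by \<open>T ^^ n\<close> cover the
  compact set of density matrices; the largest exponent of a finite subcover works for all of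
  them.\<close>

lemma uniform_strictly_positive_power:
  fixes T :: "'n::finite operator \<Rightarrow> 'n operator"
  assumes T: "superoperator T" "strongly_positive T"
  obtains N where "\<And>\<rho>. density_matrix \<rho> \<Longrightarrow> strictly_positive ((T ^^ N) \<rho>)"
proof -
  let ?D = "{\<rho> :: 'n operator. density_matrix \<rho>}"
  let ?P = "{A :: 'n operator. \<forall>x\<in>sphere 0 1. 0 < Re (quadform A x)}"
  have pos: "positive_operator ((T ^^ n) \<rho>)" if "density_matrix \<rho>" for n \<rho>
    using superoperator_funpow(2)[OF T(1)] that by (simp add: density_matrix_def)
  have op: "open ((T ^^ n) -` ?P)" for n
    using superoperator_funpow(1)[OF T(1)]
    by (intro open_vimage open_quadform_pos_on_sphere linear_continuous_on)
      (simp add: linear_conv_bounded_linear)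
  have cover: "?D \<subseteq> (\<Union>n\<in>UNIV. (T ^^ n) -` ?P)"
  proof
    fix \<rho> assume \<rho>: "\<rho> \<in> ?D"
    then obtain n where "strictly_positive ((T ^^ n) \<rho>)"
      using T(2) by (auto simp: strongly_positive_def)
    then have "(T ^^ n) \<rho> \<in> ?P"
      using strictly_positive_iff_Re[OF pos] \<rho> by simp
    then show "\<rho> \<in> (\<Union>n\<in>UNIV. (T ^^ n) -` ?P)"
      by blast
  qed
  obtain F where F: "finite F" "?D \<subseteq> (\<Union>n\<in>F. (T ^^ n) -` ?P)"
    by (rule compactE_image[OF compact_density_matrices op cover]) auto
  show ?thesis
  proof
    fix \<rho> :: "'n operator" assume \<rho>: "density_matrix \<rho>"
    then obtain n where "n \<in> F" "(T ^^ n) \<rho> \<in> ?P"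
      using F(2) by blast
    moreover from this have "strictly_positive ((T ^^ n) \<rho>)"
      using strictly_positive_iff_Re[OF pos[OF \<rho>]] by simp
    ultimately show "strictly_positive ((T ^^ Max F) \<rho>)"
      using strictly_positive_funpow_mono[OF T] \<rho> F(1) by (meson Max_ge density_matrix_def)
  qed
qed

section \<open>Doeblin minorization and contraction\<close>

text \<open>The form of \<open>S \<rho>\<close> at \<open>x\<close> attains a positive minimum over
  the compact product of density matrices and unit vectors.\<close>

lemma Doeblin_minorization:
  fixes S :: "'n::finite operator \<Rightarrow> 'n operator"
  assumes lin: "linear S"
    and pos: "\<And>\<rho>. density_matrix \<rho> \<Longrightarrow> density_matrix (S \<rho>)"
    and spos: "\<And>\<rho>. density_matrix \<rho> \<Longrightarrow> strictly_positive (S \<rho>)"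
  obtains e :: real where "e > 0" "e * CARD('n) < 1"
    "\<And>\<rho>. density_matrix \<rho> \<Longrightarrow> positive_operator (S \<rho> - e *\<^sub>R mat 1)"
proof -
  let ?D = "{\<rho> :: 'n operator. density_matrix \<rho>}"
  let ?K = "?D \<times> sphere (0 :: complex ^ 'n) 1"
  let ?f = "\<lambda>p. Re (quadform (S (fst p)) (snd p))"
  have cS: "continuous_on A S" for A
    using lin linear_conv_bounded_linear linear_continuous_on by blast
  have c: "compact ?K"
    by (intro compact_Times compact_density_matrices compact_sphere)
  obtain \<rho>0 :: "'n operator" where "density_matrix \<rho>0"
    by (rule density_matrix_exists)
  then have ne: "?K \<noteq> {}"
    using sphere_vec_nonempty by blast
  have "continuous_on ?K ?f"
    unfolding quadform_expand
    by (intro continuous_intros continuous_on_compose2[OF cS[of UNIV]]) auto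
  then obtain m where m: "m \<in> ?K" "\<forall>p\<in>?K. ?f m \<le> ?f p"
    using continuous_attains_inf[OF c ne] by blast
  \<comment> \<open>The cap keeps the trace of \<open>e *\<^sub>R mat 1\<close> strictly below 1, so
    that the remainder \<open>S \<rho> - e *\<^sub>R mat 1\<close> has positive trace and can be
    normalized.\<close>
  define e where "e = min (?f m) (1 / (2 * CARD('n)))"
  have "0 < ?f m"
    using m(1) strictly_positive_iff_Re[of "S (fst m)"] pos spos
    by (auto simp: density_matrix_def)
  then have "e > 0"
    by (simp add: e_def)
  moreover have "e * CARD('n) < 1"
  proof -
    have "e * CARD('n) \<le> 1 / (2 * CARD('n)) * CARD('n)"
      by (intro mult_right_mono) (auto simp: e_def)
    then show ?thesis
      by simp
  qed
  moreover have "positive_operator (S \<rho> - e *\<^sub>R mat 1)" if \<rho>: "density_matrix \<rho>" for \<rho>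
  proof -
    have "0 \<le> Re (quadform (S \<rho> - e *\<^sub>R mat 1) x)" if "x \<in> sphere 0 1" for x
      using bspec[OF m(2), of "(\<rho>, x)"] \<rho> that
      unfolding quadform_diff quadform_scaleR quadform_mat_1 by (simp add: e_def)
    moreover have "S \<rho> - e *\<^sub>R mat 1 \<in> hermitian_operators"
      using pos[OF \<rho>] positive_operator_mat_1
      by (auto simp: density_matrix_def positive_operator_iff
          intro!: hermitian_diff hermitian_scaleR)
    ultimately show ?thesis
      unfolding positive_operator_iff using quadform_nonneg_if_sphere by blast
  qed
  ultimately show ?thesis
    using that by blast
qed

text \<open>The common part \<open>e *\<^sub>R mat 1\<close> cancels in
  \<open>S \<rho> - S \<sigma>\<close>, and the remainders are \<open>c\<close> times density
  matrices, so each step contributes a factor \<open>c\<close> and reproduces a difference of the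
  same kind.\<close>

lemma Doeblin_contraction:
  fixes S :: "'n::finite operator \<Rightarrow> 'n operator"
  assumes lin: "linear S"
    and pos: "\<And>\<rho>. density_matrix \<rho> \<Longrightarrow> density_matrix (S \<rho>)"
    and spos: "\<And>\<rho>. density_matrix \<rho> \<Longrightarrow> strictly_positive (S \<rho>)"
  obtains c where "0 < c" "c < 1"
    "\<And>k \<rho> \<sigma>. density_matrix \<rho> \<Longrightarrow> density_matrix \<sigma> \<Longrightarrow>
      \<exists>\<rho>' \<sigma>'. density_matrix \<rho>' \<and> density_matrix \<sigma>' \<and>
        (S ^^ k) \<rho> - (S ^^ k) \<sigma> = c ^ k *\<^sub>R (\<rho>' - \<sigma>')"
proof -
  obtain e :: real where e: "e > 0" "e * CARD('n) < 1"
    "\<And>\<rho>. density_matrix \<rho> \<Longrightarrow> positive_operator (S \<rho> - e *\<^sub>R mat 1)"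
    using Doeblin_minorization[OF assms] by blast
  define c where "c = 1 - e * CARD('n)"
  have c: "0 < c" "c < 1"
    using e by (auto simp: c_def)
  have split: "\<exists>\<rho>'. density_matrix \<rho>' \<and> S \<rho> - e *\<^sub>R mat 1 = c *\<^sub>R \<rho>'"
    if \<rho>: "density_matrix \<rho>" for \<rho>
  proof -
    have "Re (trace (S \<rho> - e *\<^sub>R mat 1)) = c"
      using pos[OF \<rho>]
      by (simp add: density_matrix_def trace_sub trace_scaleR trace_mat_1 c_def)
    then show ?thesis
      using positive_operator_eq_scaleR_density_matrix[OF e(3)[OF \<rho>]] c(1) by metis
  qed
  have "\<exists>\<rho>' \<sigma>'. density_matrix \<rho>' \<and> density_matrix \<sigma>' \<and>
        (S ^^ k) \<rho> - (S ^^ k) \<sigma> = c ^ k *\<^sub>R (\<rho>' - \<sigma>')"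
    if "density_matrix \<rho>" "density_matrix \<sigma>" for k \<rho> \<sigma>
  proof (induction k)
    case 0
    show ?case
      using that by auto
  next
    case (Suc k)
    then obtain \<rho>' \<sigma>' where 1: "density_matrix \<rho>'" "density_matrix \<sigma>'"
      "(S ^^ k) \<rho> - (S ^^ k) \<sigma> = c ^ k *\<^sub>R (\<rho>' - \<sigma>')"
      by blast
    obtain \<rho>'' \<sigma>'' where 2: "density_matrix \<rho>''" "density_matrix \<sigma>''"
      "S \<rho>' - e *\<^sub>R mat 1 = c *\<^sub>R \<rho>''" "S \<sigma>' - e *\<^sub>R mat 1 = c *\<^sub>R \<sigma>''"
      using split 1 by metis
    have "(S ^^ Suc k) \<rho> - (S ^^ Suc k) \<sigma> = S ((S ^^ k) \<rho> - (S ^^ k) \<sigma>)"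
      using lin by (simp add: linear_diff)
    also have "\<dots> = c ^ k *\<^sub>R (S \<rho>' - S \<sigma>')"
      unfolding 1(3) using lin by (simp add: linear_diff linear_scale)
    also have "S \<rho>' - S \<sigma>' = c *\<^sub>R \<rho>'' - c *\<^sub>R \<sigma>''"
      unfolding 2(3,4)[symmetric] by simp
    also have "c ^ k *\<^sub>R (c *\<^sub>R \<rho>'' - c *\<^sub>R \<sigma>'') = c ^ Suc k *\<^sub>R (\<rho>'' - \<sigma>'')"
      by (simp add: algebra_simps)
    finally show ?case
      using 2 by blast
  qed
  then show ?thesis
    using c that by blast
qed

section \<open>Convergence to the stationary state\<close>

text \<open>Independent exponents \<open>m\<close> and \<open>n\<close> let one estimate give both
  the Cauchy property of an orbit and the independence of its limit from the initial state.\<close>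

lemma density_matrix_orbits_merge:
  fixes T :: "'n::finite operator \<Rightarrow> 'n operator"
  assumes T: "superoperator T" "strongly_positive T" and "0 < \<epsilon>"
  shows "\<exists>M. \<forall>\<rho> \<sigma>. density_matrix \<rho> \<longrightarrow> density_matrix \<sigma> \<longrightarrow>
    (\<forall>m\<ge>M. \<forall>n\<ge>M. norm ((T ^^ m) \<rho> - (T ^^ n) \<sigma>) < \<epsilon>)"
proof -
  obtain N where N: "\<And>\<rho>. density_matrix \<rho> \<Longrightarrow> strictly_positive ((T ^^ N) \<rho>)"
    using uniform_strictly_positive_power[OF T] by blast
  obtain c where c: "0 < c" "c < 1"
    and contr: "\<And>k \<rho> \<sigma>. density_matrix \<rho> \<Longrightarrow> density_matrix \<sigma> \<Longrightarrow>
      \<exists>\<rho>' \<sigma>'. density_matrix \<rho>' \<and> density_matrix \<sigma>' \<and>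
        ((T ^^ N) ^^ k) \<rho> - ((T ^^ N) ^^ k) \<sigma> = c ^ k *\<^sub>R (\<rho>' - \<sigma>')"
    using Doeblin_contraction[OF superoperator_funpow(1)[OF T(1)] superoperator_funpow(4)[OF T(1)] N]
    by blast
  obtain B where B: "B > 0" "\<And>\<rho> :: 'n operator. density_matrix \<rho> \<Longrightarrow> norm \<rho> \<le> B"
    using bounded_density_matrices[where 'n = 'n] unfolding bounded_pos by blast
  obtain k where k: "c ^ k < \<epsilon> / (2 * B)"
    using real_arch_pow_inv[of "\<epsilon> / (2 * B)" c] \<open>0 < \<epsilon>\<close> B(1) c by auto
  have "norm ((T ^^ m) \<rho> - (T ^^ n) \<sigma>) < \<epsilon>"
    if d: "density_matrix \<rho>" "density_matrix \<sigma>" and N: "N * k \<le> m" "N * k \<le> n" for \<rho> \<sigma> m n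
  proof -
    \<comment> \<open>The surplus \<open>j - N * k\<close> steps are applied first; they only change
      the initial density matrix, so the contraction covers unequal exponents.\<close>
    have split: "(T ^^ j) \<tau> = ((T ^^ N) ^^ k) ((T ^^ (j - N * k)) \<tau>)" if "N * k \<le> j" for j \<tau>
      using that funpow_add[of "N * k" "j - N * k" T] by (simp add: funpow_mult)
    obtain \<rho>' \<sigma>' where "density_matrix \<rho>'" "density_matrix \<sigma>'"
      and eq: "(T ^^ m) \<rho> - (T ^^ n) \<sigma> = c ^ k *\<^sub>R (\<rho>' - \<sigma>')"
      using contr[OF superoperator_funpow(4)[OF T(1)] superoperator_funpow(4)[OF T(1)],
          OF d]
        split[OF N(1)] split[OF N(2)] by metis
    then have "norm (\<rho>' - \<sigma>') \<le> 2 * B"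
      using B(2)[of \<rho>'] B(2)[of \<sigma>'] norm_triangle_ineq4[of \<rho>' \<sigma>'] by linarith
    then have "norm ((T ^^ m) \<rho> - (T ^^ n) \<sigma>) \<le> c ^ k * (2 * B)"
      unfolding eq using c by (simp add: mult_left_mono)
    also have "\<dots> < \<epsilon>"
      using k B(1) by (simp add: field_simps)
    finally show ?thesis .
  qed
  then show ?thesis
    by blast
qed

text \<open>One orbit is Cauchy, and its limit is a density matrix by closedness; every other orbit
  merges with it.\<close>

lemma strongly_positive_stationary_state:
  fixes T :: "'n::finite operator \<Rightarrow> 'n operator"
  assumes T: "superoperator T" "strongly_positive T"
  obtains \<rho>st where "density_matrix \<rho>st" "strictly_positive \<rho>st" "T \<rho>st = \<rho>st"
    "\<forall>\<rho>. density_matrix \<rho> \<longrightarrow> (\<lambda>n. (T ^^ n) \<rho>) \<longlonglongrightarrow> \<rho>st"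
proof -
  obtain \<rho>0 :: "'n operator" where \<rho>0: "density_matrix \<rho>0"
    by (rule density_matrix_exists)
  have "Cauchy (\<lambda>n. (T ^^ n) \<rho>0)"
    using density_matrix_orbits_merge[OF T] \<rho>0 by (intro CauchyI) metis
  then obtain \<rho>st where lim0: "(\<lambda>n. (T ^^ n) \<rho>0) \<longlonglongrightarrow> \<rho>st"
    using Cauchy_convergent convergent_def by blast
  have dm: "density_matrix \<rho>st"
    using closed_sequentially[OF compact_imp_closed[OF compact_density_matrices], OF _ lim0]
      superoperator_funpow(4)[OF T(1) \<rho>0] by simp
  have lim: "(\<lambda>n. (T ^^ n) \<rho>) \<longlonglongrightarrow> \<rho>st" if "density_matrix \<rho>" for \<rho>
  proof -
    have "(\<lambda>n. (T ^^ n) \<rho> - (T ^^ n) \<rho>0) \<longlonglongrightarrow> 0"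
      unfolding LIMSEQ_def dist_norm diff_zero
      using density_matrix_orbits_merge[OF T] that \<rho>0 by meson
    from tendsto_add[OF this lim0] show ?thesis
      by simp
  qed
  have "isCont T \<rho>st"
    using superoperator_linear[OF T(1)] linear_conv_bounded_linear linear_continuous_at by blast
  then have "(\<lambda>n. (T ^^ Suc n) \<rho>0) \<longlonglongrightarrow> T \<rho>st"
    using isCont_tendsto_compose[OF _ lim0] by simp
  then have fixed: "T \<rho>st = \<rho>st"
    using LIMSEQ_Suc[OF lim0] LIMSEQ_unique by blast
  then have "(T ^^ n) \<rho>st = \<rho>st" for n
    by (induction n) auto
  \<comment> \<open>Some iterate of \<open>\<rho>st\<close> is strictly positive, and that iterate
    is \<open>\<rho>st\<close> itself.\<close>
  then have "strictly_positive \<rho>st"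
    using T(2) dm by (auto simp: strongly_positive_def)
  with dm fixed lim show ?thesis
    using that by blast
qed

section \<open>Generalized eigenvectors among Hermitian operators\<close>

text \<open>Writing \<open>X\<close> as \<open>a *\<^sub>R \<rho> - b *\<^sub>R \<sigma>\<close>
  extends the convergence linearly; the coefficient \<open>a - b\<close> of the limit is the trace
  of \<open>X\<close>.\<close>

lemma tendsto_funpow_hermitian:
  assumes T: "superoperator T"
    and lim: "\<And>\<rho>. density_matrix \<rho> \<Longrightarrow> (\<lambda>n. (T ^^ n) \<rho>) \<longlonglongrightarrow> \<rho>st"
    and X: "X \<in> hermitian_operators"
  shows "(\<lambda>n. (T ^^ n) X) \<longlonglongrightarrow> Re (trace X) *\<^sub>R \<rho>st"
proof -
  obtain a b \<rho> \<sigma> where d: "density_matrix \<rho>" "density_matrix \<sigma>" and eq: "X = a *\<^sub>R \<rho> - b *\<^sub>R \<sigma>"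
    using hermitian_eq_diff_density_matrices[OF X] .
  have "(T ^^ n) X = a *\<^sub>R (T ^^ n) \<rho> - b *\<^sub>R (T ^^ n) \<sigma>" for n
    unfolding eq using superoperator_funpow(1)[OF T] by (simp add: linear_diff linear_scale)
  moreover have "(\<lambda>n. a *\<^sub>R (T ^^ n) \<rho> - b *\<^sub>R (T ^^ n) \<sigma>) \<longlonglongrightarrow> a *\<^sub>R \<rho>st - b *\<^sub>R \<rho>st"
    by (intro tendsto_intros lim d)
  moreover have "Re (trace X) = a - b"
    using d by (simp add: eq density_matrix_def trace_sub trace_scaleR)
  ultimately show ?thesis
    by (simp add: scaleR_left_diff_distrib)
qed

lemma superoperator_hermitian:
  assumes "superoperator T" "X \<in> hermitian_operators"
  shows "T X \<in> hermitian_operators"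
proof -
  obtain a b \<rho> \<sigma> where d: "density_matrix \<rho>" "density_matrix \<sigma>" and eq: "X = a *\<^sub>R \<rho> - b *\<^sub>R \<sigma>"
    using hermitian_eq_diff_density_matrices[OF assms(2)] .
  have "T \<tau> \<in> hermitian_operators" if "density_matrix \<tau>" for \<tau>
    using that
    by (intro positive_operator_hermitian superoperator_positive[OF assms(1)])
      (simp add: density_matrix_def)
  then show ?thesis
    unfolding eq using d superoperator_linear[OF assms(1)]
    by (simp add: linear_diff linear_scale hermitian_diff hermitian_scaleR)
qed

text \<open>By induction on \<open>p\<close>: the hypothesis for \<open>X - T X\<close>, which has
  trace zero, makes it vanish. The orbit of \<open>X\<close> is then constant and equal to its
  limit.\<close>

lemma generalized_fixed_point_hermitian:
  assumes T: "superoperator T"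
    and lim: "\<And>\<rho>. density_matrix \<rho> \<Longrightarrow> (\<lambda>n. (T ^^ n) \<rho>) \<longlonglongrightarrow> \<rho>st"
    and X: "X \<in> hermitian_operators" "((\<lambda>Y. 1 *\<^sub>R Y - T Y) ^^ p) X = 0"
  shows "X = Re (trace X) *\<^sub>R \<rho>st"
  using X
proof (induction p arbitrary: X)
  case 0
  then show ?case by (simp add: trace_def)
next
  case (Suc p)
  let ?Y = "X - T X"
  have "?Y \<in> hermitian_operators"
    using Suc.prems(1) superoperator_hermitian[OF T] hermitian_diff by blast
  moreover have "((\<lambda>Y. 1 *\<^sub>R Y - T Y) ^^ p) ?Y = 0"
    using Suc.prems(2) unfolding funpow_Suc_right by simp
  moreover have "trace ?Y = 0"
    using T by (simp add: superoperator_def trace_sub)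
  ultimately have "T X = X"
    using Suc.IH[of ?Y] by simp
  then have "(T ^^ n) X = X" for n
    by (induction n) auto
  then show ?case
    using tendsto_funpow_hermitian[OF T lim Suc.prems(1)] LIMSEQ_const_iff by auto
qed

theorem theorem1p4:
  fixes T :: "('v::finite \<times> 's::finite) operator \<Rightarrow> ('v \<times> 's) operator"
  assumes "superoperator T"
    and "strongly_positive T"
  shows "simple_eigenvalue T 1 \<and>
    (\<exists>\<rho>st. {X. eigenvector_on_hermitian T 1 X \<and> trace X = 1} = {\<rho>st} \<and>
      density_matrix \<rho>st \<and> strictly_positive \<rho>st \<and>
      (\<forall>\<rho>0. density_matrix \<rho>0 \<longrightarrow> (\<lambda>n. (T ^^ n) \<rho>0) \<longlonglongrightarrow> \<rho>st))"
proof -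
  obtain \<rho>st where st: "density_matrix \<rho>st" "strictly_positive \<rho>st" "T \<rho>st = \<rho>st"
    and lim_all: "\<forall>\<rho>. density_matrix \<rho> \<longrightarrow> (\<lambda>n. (T ^^ n) \<rho>) \<longlonglongrightarrow> \<rho>st"
    by (rule strongly_positive_stationary_state[OF assms])
  then have lim: "(\<lambda>n. (T ^^ n) \<rho>) \<longlonglongrightarrow> \<rho>st" if "density_matrix \<rho>" for \<rho>
    using that by blast
  have herm: "\<rho>st \<in> hermitian_operators" and tr: "trace \<rho>st = 1"
    using st(1) positive_operator_hermitian by (auto simp: density_matrix_def)
  then have nz: "\<rho>st \<noteq> 0"
    by (auto simp: trace_def)
  have eig: "eigenvector_on_hermitian T 1 \<rho>st"
    using herm nz st(3) by (simp add: eigenvector_on_hermitian_def)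
  have uniq: "X = \<rho>st" if "eigenvector_on_hermitian T 1 X" "trace X = 1" for X
    using generalized_fixed_point_hermitian[OF assms(1) lim, of X 1] that
    by (simp add: eigenvector_on_hermitian_def)
  \<comment> \<open>All the kernels in the supremum are the same line, spanned by
    \<open>\<rho>st\<close>.\<close>
  have dim: "dim {X \<in> hermitian_operators. ((\<lambda>Y. 1 *\<^sub>R Y - T Y) ^^ p) X = 0} = 1"
    if "p > 0" for p
  proof -
    \<comment> \<open>Here \<open>p > 0\<close> matters: the first application already gives 0, and
      the remaining ones keep it 0.\<close>
    have "((\<lambda>Y. 1 *\<^sub>R Y - T Y) ^^ p) (r *\<^sub>R \<rho>st) = 0" for r
    proof -
      have lin: "T (r *\<^sub>R X) = r *\<^sub>R T X" for r X
        using superoperator_linear[OF assms(1)] by (rule linear_scale)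
      have "((\<lambda>Y. 1 *\<^sub>R Y - T Y) ^^ q) 0 = 0" for q
        using lin[of 0] by (induction q) auto
      then show ?thesis
        using that by (cases p) (auto simp: funpow_Suc_right lin st(3) simp del: funpow.simps)
    qed
    moreover have "X = Re (trace X) *\<^sub>R \<rho>st"
      if "X \<in> hermitian_operators" "((\<lambda>Y. 1 *\<^sub>R Y - T Y) ^^ p) X = 0" for X
      by (rule generalized_fixed_point_hermitian[OF assms(1) lim that])
    ultimately have "{X \<in> hermitian_operators. ((\<lambda>Y. 1 *\<^sub>R Y - T Y) ^^ p) X = 0} = span {\<rho>st}"
      using herm hermitian_scaleR
      by (auto simp: span_singleton)
    then show ?thesis
      using nz by (simp add: dim_span)
  qed
  have "eigenvalue_rank T 1 = (SUP p\<in>{p::nat. p > 0}. 1)"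
    unfolding eigenvalue_rank_def using dim by (intro SUP_cong) auto
  also have "\<dots> = 1"
    by (intro cSUP_const) auto
  finally have "simple_eigenvalue T 1"
    using eig by (auto simp: simple_eigenvalue_def)
  moreover have "{X. eigenvector_on_hermitian T 1 X \<and> trace X = 1} = {\<rho>st}"
    using eig tr uniq by blast
  ultimately show ?thesis
    using st lim_all by blast
qed

end
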